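(* Consider the game $\mathbf{0.33}$. Let $S$ be a subdivided star all of whose paths have $1$ or $2$ vertices, with $i\ge 0$ paths in total, of which $j$ ($0\le j\le i$) have $2$ vertices. Then $\mathcal{G}(S)$ is as follows (listing values for $j=0,1,\ldots,i$): \begin{itemize} \item $i=0$: $1$; \item $i=1$: $2, 0$; \item $i=2$: $0,1,2$; \item $i=3$: $1,2,0,1$; \item $i\ge 4$ even: $\mathcal{G}(S)=0,3,1,2$ for $j=0,1,2,3$ respectively, and for $j\ge 4$, $\mathcal{G}(S)=0$ if $j$ is even and $\mathcal{G}(S)=3$ if $j$ is odd; \item $i\ge 5$ odd: $\mathcal{G}(S)=1,2,0,3$ for $j=0,1,2,3$ respectively, and for $j\ge 4$, $\mathcal{G}(S)=1$ if $j$ is even and $\mathcal{G}(S)=2$ if $j$ is odd. \end{itemize} (Also, the empty graph has Grundy value $0$.)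
   Context: The game $\mathbf{0.33}$ on a finite graph $G$: players alternate; a move chooses a set $X$ of one vertex or of two adjacent vertices of $G$, lying in a connected component $H$ of $G$, such that $H-X$ is empty or connected, and deletes $X$. A player unable to move loses (normal play). Grundy value: $\mathcal{G}(G)=\mathrm{mex}\{\mathcal{G}(G'): G' \text{ reachable in one move}\}$, with $\mathrm{mex}(A)$ the least nonnegative integer not in $A$. Subdivided star $S_{\ell_1,\ldots,\ell_k}$ ($k\ge0$, $\ell_i\ge1$): a central vertex $c$ together with $k$ vertex-disjoint paths having $\ell_1,\ldots,\ell_k$ vertices, each with one endpoint adjacent to $c$; for $k=0$ it is a single vertex. *)

theory Defs
  imports "Graph_Theory.Graph_Theory"
begin

text \<open>
  Finite simple graphs are symmetric loop-free digraphs without parallel arcs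
  (locale \<^locale>\<open>graph\<close>, which admits the empty graph). In such a graph
  \<^const>\<open>pre_digraph.sccs\<close> consists of the connected components.
\<close>

definition moves033 :: "('a, 'b) pre_digraph \<Rightarrow> ('a, 'b) pre_digraph set" where
  "moves033 G = {G \<restriction> (verts G - X) | X H.
     ((\<exists>u. X = {u}) \<or> (\<exists>u v. u \<rightarrow>\<^bsub>G\<^esub> v \<and> X = {u, v})) \<and>
     H \<in> pre_digraph.sccs G \<and> X \<subseteq> verts H \<and>
     (verts H - X = {} \<or> connected (H \<restriction> (verts H - X)))}"

definition mex :: "nat set \<Rightarrow> nat" where
  "mex A = (LEAST n. n \<notin> A)"

lemma graph_moves033:
  assumes "graph G" "G' \<in> moves033 G"
  shows "graph G'"
proof -
  interpret graph G by fact
  obtain X where "G' = G \<restriction> (verts G - X)"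
    using assms(2) by (auto simp: moves033_def)
  then have ind: "induced_subgraph G' G" by (auto intro: induced_induce)
  from ind interpret G': digraph G' by (rule digraphI_induced)
  from ind have "symmetric G'" by (rule induced_graph_imp_symmetric[OF sym_arcs])
  then show ?thesis by unfold_locales
qed

lemma card_verts_moves033:
  assumes "graph G" "G' \<in> moves033 G"
  shows "card (verts G') < card (verts G)"
proof -
  interpret graph G by fact
  obtain X H where G': "G' = G \<restriction> (verts G - X)" and "X \<noteq> {}"
    and "H \<in> sccs" "X \<subseteq> verts H"
    using assms(2) by (auto simp: moves033_def)
  then have "X \<subseteq> verts G"
    by (auto simp: sccs_def induced_subgraph_def subgraph_def)
  with \<open>X \<noteq> {}\<close> show ?thesis
    unfolding G' by (auto intro!: psubset_card_mono)
qed

text \<open>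
  The game is played on finite simple graphs only; the value elsewhere is a dummy.
\<close>

function grundy :: "('a, 'b) pre_digraph \<Rightarrow> nat" where
  "grundy G = (if graph G then mex (grundy ` moves033 G) else 0)"
  by auto
termination
  by (relation "measure (\<lambda>G. card (verts G))") (auto intro: card_verts_moves033)

declare grundy.simps [simp del]

text \<open>
  The lists in \<open>ps\<close> are the vertex sequences of the paths, each starting at the
  endpoint adjacent to the centre \<open>c\<close>; \<open>ls\<close> lists their numbers of vertices.
\<close>

definition subdivided_star :: "nat list \<Rightarrow> ('a, 'b) pre_digraph \<Rightarrow> bool" where
  "subdivided_star ls G \<longleftrightarrow> graph G \<and> (\<forall>l \<in> set ls. l \<ge> 1) \<and>
     (\<exists>c ps. map length ps = ls \<and> distinct (c # concat ps) \<and>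
        verts G = set (c # concat ps) \<and>
        arcs_ends G = (\<Union>p \<in> set ps. set (vwalk_arcs (c # p)) \<union> (set (vwalk_arcs (c # p)))\<inverse>))"

end

theory Submission
  imports Defs
begin

text \<open>
  Consider a star with \<open>a\<close> paths of one vertex and \<open>b\<close> paths of two vertices. Deleting a
  leaf next to the centre, the end of a long path, or a whole long path leads to
  \<open>(a - 1, b)\<close>, \<open>(a + 1, b - 1)\<close> and \<open>(a, b - 1)\<close>. Any other move must delete the centre, and
  it keeps the rest connected only if at most one path survives; up to isomorphism this
  yields something new only for \<open>(0, 0)\<close> and \<open>(1, 0)\<close> (the empty graph) and for \<open>(2, 0)\<close>
  (a single vertex). The claimed table satisfies the resulting mex recursion.
\<close>

section \<open>Induced subgraphs, connectivity, and moves in a connected graph\<close>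

lemma arcs_ends_induce_subgraph:
  "arcs_ends (G \<restriction> W) = arcs_ends G \<inter> W \<times> W"
  by (auto simp: arcs_ends_conv)

lemma graph_induce_subgraph:
  assumes "graph G" "W \<subseteq> verts G"
  shows "graph (G \<restriction> W)"
proof -
  interpret graph G by fact
  have ind: "induced_subgraph (G \<restriction> W) G" using assms(2) by (rule induced_induce)
  from ind interpret G': digraph "G \<restriction> W" by (rule digraphI_induced)
  from ind have "symmetric (G \<restriction> W)" by (rule induced_graph_imp_symmetric[OF sym_arcs])
  then show ?thesis by unfold_locales
qed

lemma graph_strongly_connected:
  assumes "graph G" "connected G"
  shows "strongly_connected G"
proof -
  interpret graph G by fact
  show ?thesis using assms(2) sym_arcs by (intro symmetric_connected_imp_strongly_connected)
qed

text \<open>A walk inside \<open>W\<close> that starts in \<open>K\<close> never leaves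
  \<open>K\<close>, whereas connectedness lets it reach all of \<open>W\<close>. This is the tool
  against illegal moves: a small part cut off by a deletion must be all that survives.\<close>

lemma connected_induce_closed:
  assumes "graph G" "W \<subseteq> verts G" "connected (G \<restriction> W)" "K \<subseteq> W" "K \<noteq> {}"
    and closed: "\<And>u v. u \<in> K \<Longrightarrow> v \<in> W \<Longrightarrow> (u, v) \<in> arcs_ends G \<Longrightarrow> v \<in> K"
  shows "W = K"
proof -
  have "graph (G \<restriction> W)" using assms by (intro graph_induce_subgraph)
  then have sc: "strongly_connected (G \<restriction> W)"
    using assms(3) by (rule graph_strongly_connected)
  obtain k where k: "k \<in> K" using assms(5) by auto
  have "w \<in> K" if "w \<in> W" for w
  proof -
    have "k \<rightarrow>\<^sup>*\<^bsub>G \<restriction> W\<^esub> w" using sc k that assms(4) by (auto simp: strongly_connected_def)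
    then have "(k, w) \<in> (arcs_ends (G \<restriction> W))\<^sup>*" by (rule reachable_rtranclI)
    then show ?thesis
      using k closed by (induction) (auto simp: arcs_ends_induce_subgraph)
  qed
  then show ?thesis using assms(4) by auto
qed

text \<open>Symmetry makes \<open>G\<close> strongly connected, so maximality rules out components
  on fewer vertices, and an induced subgraph on all vertices is \<open>G\<close> itself.\<close>

lemma sccs_connected_graph:
  assumes "graph G" "connected G"
  shows "pre_digraph.sccs G = {G}"
proof -
  interpret graph G by fact
  have sc: "strongly_connected G" using assms by (rule graph_strongly_connected)
  have ind: "induced_subgraph G G" by (auto simp: induced_subgraph_def subgraph_def compatible_def wf_digraph_axioms)
  show ?thesis
  proof (intro equalityI subsetI)
    fix H assume H: "H \<in> sccs"
    then have H': "induced_subgraph H G" by (auto simp: sccs_def)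
    then have "verts H \<subseteq> verts G" by (auto simp: induced_subgraph_def subgraph_def)
    with H sc ind have "verts H = verts G" by (auto simp: sccs_def)
    with H' ind show "H \<in> {G}" by (metis induced_eq_verts_imp_eq singletonI)
  next
    fix H assume "H \<in> {G}"
    with sc ind show "H \<in> sccs"
      by (auto simp: sccs_def induced_subgraph_def subgraph_def)
  qed
qed

lemma moves033_connected:
  assumes "graph G" "connected G"
  shows "moves033 G = {G \<restriction> (verts G - X) | X.
     ((\<exists>u. X = {u}) \<or> (\<exists>u v. u \<rightarrow>\<^bsub>G\<^esub> v \<and> X = {u, v})) \<and> X \<subseteq> verts G \<and>
     (verts G - X = {} \<or> connected (G \<restriction> (verts G - X)))}"
  unfolding moves033_def sccs_connected_graph[OF assms] by auto

section \<open>Stars with paths of one or two vertices\<close>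

text \<open>
  \<open>A\<close> consists of the paths with one vertex, \<open>B\<close> of the vertices adjacent to \<open>c\<close> on the paths
  with two vertices, and \<open>f\<close> sends each of them to the far end of its path.
\<close>

definition star_on :: "'a \<Rightarrow> 'a set \<Rightarrow> 'a set \<Rightarrow> ('a \<Rightarrow> 'a) \<Rightarrow> ('a, 'b) pre_digraph \<Rightarrow> bool" where
  "star_on c A B f G \<longleftrightarrow> graph G \<and> c \<notin> A \<union> B \<union> f ` B \<and> A \<inter> B = {} \<and> (A \<union> B) \<inter> f ` B = {} \<and>
     inj_on f B \<and> verts G = insert c (A \<union> B \<union> f ` B) \<and>
     (\<forall>u v. (u, v) \<in> arcs_ends G \<longleftrightarrow>
        u = c \<and> v \<in> A \<union> B \<or> v = c \<and> u \<in> A \<union> B \<or> u \<in> B \<and> v = f u \<or> v \<in> B \<and> u = f v)"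

text \<open>Recording only the two numbers of paths, with centre and vertex sets quantified away,
  takes the place of reasoning up to isomorphism.\<close>

definition star12 :: "nat \<Rightarrow> nat \<Rightarrow> ('a, 'b) pre_digraph \<Rightarrow> bool" where
  "star12 a b G \<longleftrightarrow> (\<exists>c A B f. star_on c A B f G \<and> card A = a \<and> card B = b)"

lemma star12I: "star_on c A B f G \<Longrightarrow> card A = a \<Longrightarrow> card B = b \<Longrightarrow> star12 a b G"
  unfolding star12_def by blast

lemma star_on_finite:
  assumes "star_on c A B f G"
  shows "finite A" "finite B"
proof -
  interpret graph G using assms by (simp add: star_on_def)
  have "finite (verts G)" by simp
  moreover have "verts G = insert c (A \<union> B \<union> f ` B)" using assms by (simp add: star_on_def)
  ultimately show "finite A" "finite B" by simp_all
qed

text \<open>Every vertex is reached from \<open>c\<close> in at most two steps, and symmetry gives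
  the way back.\<close>

lemma connected_star_on:
  assumes "star_on c A B f G"
  shows "connected G"
proof -
  interpret graph G using assms by (simp add: star_on_def)
  have V: "verts G = insert c (A \<union> B \<union> f ` B)" using assms by (simp add: star_on_def)
  have E: "\<And>u v. (u, v) \<in> arcs_ends G \<longleftrightarrow>
        u = c \<and> v \<in> A \<union> B \<or> v = c \<and> u \<in> A \<union> B \<or> u \<in> B \<and> v = f u \<or> v \<in> B \<and> u = f v"
    using assms unfolding star_on_def by blast
  have AB: "c \<rightarrow>\<^sup>*\<^bsub>G\<^esub> v" if "v \<in> A \<union> B" for v using that E by (intro reachable_adjI) auto
  have "c \<rightarrow>\<^sup>*\<^bsub>G\<^esub> f v" if "v \<in> B" for v
  proof -
    have "c \<rightarrow>\<^sup>*\<^bsub>G\<^esub> v" using AB that by auto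
    moreover have "v \<rightarrow>\<^bsub>G\<^esub> f v" using E that by auto
    ultimately show ?thesis by (rule reachable_adj_trans)
  qed
  with AB V have "c \<rightarrow>\<^sup>*\<^bsub>G\<^esub> v" if "v \<in> verts G" for v using that by auto
  moreover have "v \<rightarrow>\<^sup>*\<^bsub>G\<^esub> c" if "c \<rightarrow>\<^sup>*\<^bsub>G\<^esub> v" for v using that by (rule symmetric_reachable[OF sym_arcs])
  ultimately have "strongly_connected G"
    using V by (intro strongly_connectedI) (blast intro: reachable_trans)+
  then show ?thesis
    unfolding connected_def strongly_connected_def by (auto intro: reachable_mk_symmetricI)
qed

text \<open>Arcs have to be compared only inside \<open>W\<close>: if an end lies outside, both
  sides are false, because the star pattern on the right only relates vertices of
  \<open>W\<close>.\<close>

lemma star_on_induce: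
  assumes "star_on c A B f G" "W \<subseteq> verts G"
    and "c' \<notin> A' \<union> B' \<union> f ` B'" "A' \<inter> B' = {}" "(A' \<union> B') \<inter> f ` B' = {}" "inj_on f B'"
    and "W = insert c' (A' \<union> B' \<union> f ` B')"
    and "\<And>u v. u \<in> W \<Longrightarrow> v \<in> W \<Longrightarrow> (u, v) \<in> arcs_ends G \<longleftrightarrow>
        u = c' \<and> v \<in> A' \<union> B' \<or> v = c' \<and> u \<in> A' \<union> B' \<or> u \<in> B' \<and> v = f u \<or> v \<in> B' \<and> u = f v"
  shows "star_on c' A' B' f (G \<restriction> W)"
proof -
  have "graph (G \<restriction> W)" using assms by (intro graph_induce_subgraph) (auto simp: star_on_def)
  moreover have "(u, v) \<in> arcs_ends (G \<restriction> W) \<longleftrightarrow>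
      u = c' \<and> v \<in> A' \<union> B' \<or> v = c' \<and> u \<in> A' \<union> B' \<or> u \<in> B' \<and> v = f u \<or> v \<in> B' \<and> u = f v"
    for u v
  proof (cases "u \<in> W \<and> v \<in> W")
    case True
    then show ?thesis using assms(8)[of u v] by (simp add: arcs_ends_induce_subgraph)
  next
    case False
    then show ?thesis using assms(7) by (auto simp: arcs_ends_induce_subgraph)
  qed
  ultimately show ?thesis
    using assms(3-7) unfolding star_on_def by simp
qed

section \<open>Deletions in a fixed star\<close>

context
  fixes c :: 'a and A B :: "'a set" and f :: "'a \<Rightarrow> 'a" and G :: "('a, 'b) pre_digraph"
  assumes star: "star_on c A B f G"
begin

lemma star_graph: "graph G"
  and star_disjoint: "c \<notin> A \<union> B \<union> f ` B" "A \<inter> B = {}" "(A \<union> B) \<inter> f ` B = {}"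
  and star_inj: "inj_on f B"
  and star_verts: "verts G = insert c (A \<union> B \<union> f ` B)"
  and star_arcs: "(u, v) \<in> arcs_ends G \<longleftrightarrow>
        u = c \<and> v \<in> A \<union> B \<or> v = c \<and> u \<in> A \<union> B \<or> u \<in> B \<and> v = f u \<or> v \<in> B \<and> u = f v"
  using star by (simp_all add: star_on_def)

lemma star_remove_leaf:
  assumes "a \<in> A"
  shows "star_on c (A - {a}) B f (G \<restriction> (verts G - {a}))"
  using assms star_disjoint star_inj
  by (intro star_on_induce[OF star]) (auto simp: star_verts star_arcs)

text \<open>The path through \<open>b\<close> now has one vertex, so \<open>b\<close> changes from
  \<open>B\<close> to \<open>A\<close>. Injectivity of \<open>f\<close> ensures that no other path
  loses its tip.\<close>

lemma star_remove_tip: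
  assumes "b \<in> B"
  shows "star_on c (insert b A) (B - {b}) f (G \<restriction> (verts G - {f b}))"
  using assms star_disjoint star_inj
  by (intro star_on_induce[OF star]) (auto simp: star_verts star_arcs inj_on_def)

lemma star_remove_branch:
  assumes "b \<in> B"
  shows "star_on c A (B - {b}) f (G \<restriction> (verts G - {b, f b}))"
  using assms star_disjoint star_inj
  by (intro star_on_induce[OF star]) (auto simp: star_verts star_arcs inj_on_def)

text \<open>Without loops a lone vertex has no arcs, so it is a star without paths, centred at
  itself.\<close>

lemma star_keep_vertex:
  assumes "v \<in> verts G"
  shows "star_on v {} {} f (G \<restriction> {v})"
proof -
  interpret graph G by (rule star_graph)
  show ?thesis
    using assms by (intro star_on_induce[OF star]) (auto dest: adj_not_same)
qed

text \<open>A long path cut off from \<open>c\<close> is recentred at \<open>b\<close>, with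
  \<open>f b\<close> as its only leaf.\<close>

lemma star_keep_branch:
  assumes "b \<in> B"
  shows "star_on b {f b} {} f (G \<restriction> {b, f b})"
  using assms star_disjoint star_inj
  by (intro star_on_induce[OF star]) (auto simp: star_verts star_arcs)

text \<open>Connectedness of the remainder comes from its being a star, possibly with another
  centre.\<close>

lemma star_moveI:
  assumes "(\<exists>u. X = {u}) \<or> (\<exists>u v. u \<rightarrow>\<^bsub>G\<^esub> v \<and> X = {u, v})" "X \<subseteq> verts G"
    and "verts G - X = {} \<or> star_on c' A' B' f' (G \<restriction> (verts G - X))"
  shows "G \<restriction> (verts G - X) \<in> moves033 G"
proof -
  have "verts G - X = {} \<or> connected (G \<restriction> (verts G - X))"
    using assms(3) by (auto dest: connected_star_on)
  then show ?thesis
    unfolding moves033_connected[OF star_graph connected_star_on[OF star]] mem_Collect_eq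
    by (intro exI[of _ X] conjI refl assms(1,2))
qed

text \<open>If the centre survives, the move shortens or removes one path. If it is deleted, the
  surviving paths fall apart, so at most one remains; as \<open>X\<close> has at most one further
  vertex, this bounds \<open>A\<close> and \<open>B\<close>.\<close>

lemma star_moves_cases:
  assumes "G' \<in> moves033 G"
  shows "(\<exists>a \<in> A. star_on c (A - {a}) B f G') \<or>
    (\<exists>b \<in> B. star_on c (insert b A) (B - {b}) f G' \<or> star_on c A (B - {b}) f G') \<or>
    verts G' = {} \<and> B = {} \<and> card A \<le> 1 \<or>
    star12 0 0 G' \<and> B = {} \<and> card A \<le> 2 \<and> card A > 0 \<or>
    star12 1 0 G' \<and> card B = 1 \<and> card A \<le> 1 \<or>
    star12 0 0 G' \<and> card B = 1 \<and> A = {}"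
    (is "?leaf \<or> ?branch \<or> ?rest")
proof -
  obtain X where X: "(\<exists>u. X = {u}) \<or> (\<exists>u v. u \<rightarrow>\<^bsub>G\<^esub> v \<and> X = {u, v})" "X \<subseteq> verts G"
    and G': "G' = G \<restriction> (verts G - X)"
    and con: "verts G - X = {} \<or> connected (G \<restriction> (verts G - X))"
    using assms unfolding moves033_connected[OF star_graph connected_star_on[OF star]] mem_Collect_eq
    by (elim exE conjE) (rule that)
  \<comment> \<open>A nonempty surviving set with no arc to the other survivors is the whole
    remainder.\<close>
  have only: "verts G - X = K"
    if "K \<subseteq> verts G - X" "K \<noteq> {}"
      "\<And>u v. u \<in> K \<Longrightarrow> v \<in> verts G - X \<Longrightarrow> (u, v) \<in> arcs_ends G \<Longrightarrow> v \<in> K" for K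
  proof (rule connected_induce_closed[OF star_graph _ _ that])
    show "connected (G \<restriction> (verts G - X))" using con that(1,2) by auto
  qed auto
  have rest: "x \<in> K" if "verts G - X = K" "x \<in> A \<union> B \<union> f ` B" "x \<notin> X" for x K
    using that by (auto simp: star_verts)
  have X1: "finite X" "card (X - {c}) \<le> 1" if "c \<in> X"
  proof -
    \<comment> \<open>A singleton is written as \<open>{u, u}\<close>, so that both shapes of
      \<open>X\<close> are treated alike.\<close>
    obtain u v where "X = {u, v}" using X(1) by (metis insert_absorb2)
    with that have "X - {c} \<subseteq> {if u = c then v else u}" and "finite X" by auto
    then show "finite X" "card (X - {c}) \<le> 1"
      using card_mono[of "{if u = c then v else u}" "X - {c}"] by auto
  qed
  have tip: "f b \<notin> A" "f b \<notin> B" "f b \<noteq> c" "f b \<noteq> b" "b \<noteq> c" "b \<notin> A" if "b \<in> B" for b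
  proof -
    have "f b \<in> f ` B" using that by (rule imageI)
    then show "f b \<notin> A" "f b \<notin> B" "f b \<noteq> c" "b \<noteq> c" "b \<notin> A"
      using that star_disjoint by blast+
    then show "f b \<noteq> b" using that by metis
  qed
  note simps = star_verts star_arcs inj_on_eq_iff[OF star_inj]
  \<comment> \<open>Deleting only the inner vertex of a long path separates its tip from the
    surviving centre.\<close>
  have mid: False if "b \<in> B" "X = {b}" for b
  proof -
    have "verts G - X = {f b}"
      using that tip[of b] by (intro only) (auto simp: simps dest: tip(2))
    then show False using that star_disjoint rest[of "{f b}" c] by (auto simp: star_verts)
  qed
  \<comment> \<open>A leaf surviving the centre is isolated, hence alone. All other leaves lie in
    \<open>X - {c}\<close>, which has at most one element.\<close>
  have leaf_case: ?rest if "c \<in> X" "a \<in> A - X" "X \<subseteq> insert c A" for a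
  proof -
    have *: "verts G - X = {a}"
      using that star_disjoint by (intro only) (auto simp: star_verts star_arcs)
    have B: "B = {}" using rest[OF *] that star_disjoint by blast
    have "A \<subseteq> insert a (X - {c})" using rest[OF *] star_disjoint by blast
    then have "card A \<le> card (insert a (X - {c}))" using X1 that by (intro card_mono) auto
    also have "\<dots> \<le> 2" using X1 that card_insert_le_m1[of 2 "X - {c}" a] by simp
    finally have "card A \<le> 2" .
    moreover have "card A > 0" using that star_on_finite[OF star] by (auto simp: card_gt_0_iff)
    moreover have "star12 0 0 G'"
      using star_keep_vertex[of a] that unfolding G' * by (intro star12I) (auto simp: star_verts)
    ultimately show ?thesis using B by blast
  qed
  \<comment> \<open>Once \<open>c\<close> is gone, \<open>b\<close> and \<open>f b\<close> have only
    each other as neighbours, so they form the whole remainder.\<close>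
  have branch_case: ?rest if "c \<in> X" "b \<in> B" "X \<subseteq> insert c A" for b
  proof -
    have "b \<notin> X" "f b \<notin> X" using that tip[of b] by auto
    then have *: "verts G - X = {b, f b}"
      using that tip[of b] by (intro only) (auto simp: simps dest: tip(2))
    have "B = {b}" using rest[OF *] that star_disjoint by blast
    then have "card B = 1" by simp
    moreover have "A \<subseteq> X - {c}" using rest[OF *] that star_disjoint by blast
    then have "card A \<le> 1" using card_mono[of "X - {c}" A] X1 that by simp
    moreover have "star12 1 0 G'"
      using star_keep_branch[of b] that unfolding G' * by (intro star12I) auto
    ultimately show ?thesis by blast
  qed
  \<comment> \<open>Deleting both neighbours \<open>c\<close> and \<open>b\<close> isolates part of
    the path: \<open>f b\<close> must be the only survivor.\<close>
  have tip_case: ?rest if "b \<in> B" "X = {c, b}" for b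
  proof -
    have *: "verts G - X = {f b}"
      using that tip[of b] by (intro only) (auto simp: simps dest: tip(2))
    have "A = {}" "B = {b}" using rest[OF *] that star_disjoint by blast+
    moreover have "star12 0 0 G'"
      using star_keep_vertex[of "f b"] that unfolding G' * by (intro star12I) (auto simp: star_verts)
    ultimately show ?thesis by auto
  qed
  have centre_case: ?rest if "c \<in> X" "X \<subseteq> insert c A"
  proof (cases "B = {} \<and> A \<subseteq> X")
    case True
    then have "A \<subseteq> X - {c}" "verts G' = {}" using that star_disjoint by (auto simp: G' star_verts)
    then show ?thesis using True card_mono[of "X - {c}" A] X1 that by simp
  next
    case False
    then show ?thesis using leaf_case branch_case that by blast
  qed
  \<comment> \<open>There are four kinds of vertices and three kinds of edges, the latter up to
    orientation.\<close>
  consider "X = {c}" | a where "a \<in> A" "X = {a}" | b where "b \<in> B" "X = {b}"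
    | b where "b \<in> B" "X = {f b}" | b where "b \<in> B" "X = {b, f b}"
    | a where "a \<in> A" "X = {c, a}" | b where "b \<in> B" "X = {c, b}"
    using X(1)
  proof (elim disjE exE conjE)
    fix u assume u: "X = {u}"
    then have "u \<in> insert c (A \<union> B \<union> f ` B)" using X(2) by (simp add: star_verts)
    then show thesis using u that(1-4) by blast
  next
    fix u v assume uv: "u \<rightarrow>\<^bsub>G\<^esub> v" "X = {u, v}"
    from uv(1) show thesis
      unfolding star_arcs using uv(2) that(5-7) by (metis UnE insert_commute)
  qed
  then show ?thesis
  proof cases
    case 1 then show ?thesis using centre_case by simp
  next
    case (2 a) then show ?thesis using star_remove_leaf G' by blast
  next
    case (3 b) then show ?thesis using mid by blast
  next
    case (4 b) then show ?thesis using star_remove_tip G' by blast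
  next
    case (5 b) then show ?thesis using star_remove_branch G' by blast
  next
    case (6 a) then show ?thesis using centre_case by simp
  next
    case (7 b) then show ?thesis using tip_case by blast
  qed
qed

end

section \<open>Moves in terms of the numbers of short and long paths\<close>

text \<open>Most moves that delete the centre give the same pair of numbers as an ordinary move and
  are absorbed there.\<close>

lemma star12_moves:
  assumes "star12 a b G" "G' \<in> moves033 G"
  shows "(a > 0 \<and> star12 (a - 1) b G') \<or> (b > 0 \<and> (star12 (a + 1) (b - 1) G' \<or> star12 a (b - 1) G'))
    \<or> verts G' = {} \<and> b = 0 \<and> a \<le> 1 \<or> star12 0 0 G' \<and> b = 0 \<and> a = 2"
proof -
  obtain c A B f where G: "star_on c A B f G" and ab: "card A = a" "card B = b"
    using assms(1) unfolding star12_def by blast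
  note fin = star_on_finite[OF G]
  have nb: "x \<notin> A" if "x \<in> B" for x using G that unfolding star_on_def by blast
  from star_moves_cases[OF G assms(2)] show ?thesis
  proof (elim disjE bexE conjE)
    fix x assume x: "x \<in> A" and G': "star_on c (A - {x}) B f G'"
    then have "star12 (a - 1) b G'" using fin ab by (intro star12I[OF G']) auto
    moreover have "a > 0" using x fin ab by (auto simp: card_gt_0_iff)
    ultimately show ?thesis by simp
  next
    fix x assume x: "x \<in> B" and G': "star_on c (insert x A) (B - {x}) f G'"
    then have "star12 (a + 1) (b - 1) G'" using fin ab nb by (intro star12I[OF G']) auto
    moreover have "b > 0" using x fin ab by (auto simp: card_gt_0_iff)
    ultimately show ?thesis by simp
  next
    fix x assume x: "x \<in> B" and G': "star_on c A (B - {x}) f G'"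
    then have "star12 a (b - 1) G'" using fin ab by (intro star12I[OF G']) auto
    moreover have "b > 0" using x fin ab by (auto simp: card_gt_0_iff)
    ultimately show ?thesis by simp
  next
    assume "star12 0 0 G'" "B = {}" "card A \<le> 2" "card A > 0"
    \<comment> \<open>For \<open>a = 1\<close> the result is also that of deleting the leaf; only
      \<open>a = 2\<close> is a new option.\<close>
    moreover from this have "a = 1 \<or> a = 2" using ab by auto
    ultimately show ?thesis using ab by auto
  next
    assume "star12 1 0 G'" "card B = 1" "card A \<le> 1"
    \<comment> \<open>For \<open>a = 0\<close> this agrees with deleting the tip, for
      \<open>a = 1\<close> with deleting the long path.\<close>
    moreover from this have "a = 0 \<or> a = 1" using ab by auto
    ultimately show ?thesis using ab by auto
  next
    assume "verts G' = {}" "B = {}" "card A \<le> 1"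
    then show ?thesis using ab by simp
  next
    \<comment> \<open>This agrees with deleting the only path, since \<open>a = 0\<close> and
      \<open>b = 1\<close>.\<close>
    assume "star12 0 0 G'" "card B = 1" "A = {}"
    then show ?thesis using ab by simp
  qed
qed

text \<open>The deleted sets are, in order: a leaf, a tip, a whole long path, the centre with all
  leaves, and the centre with one of two leaves.\<close>

lemma star12_moves_exist:
  assumes "star12 a b G"
  shows "a > 0 \<Longrightarrow> \<exists>G' \<in> moves033 G. star12 (a - 1) b G'"
    and "b > 0 \<Longrightarrow> \<exists>G' \<in> moves033 G. star12 (a + 1) (b - 1) G'"
    and "b > 0 \<Longrightarrow> \<exists>G' \<in> moves033 G. star12 a (b - 1) G'"
    and "b = 0 \<Longrightarrow> a \<le> 1 \<Longrightarrow> \<exists>G' \<in> moves033 G. verts G' = {}"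
    and "b = 0 \<Longrightarrow> a = 2 \<Longrightarrow> \<exists>G' \<in> moves033 G. star12 0 0 G'"
proof -
  obtain c A B f where G: "star_on c A B f G" and ab: "card A = a" "card B = b"
    using assms(1) unfolding star12_def by blast
  note fin = star_on_finite[OF G]
  note V = star_verts[OF G] and E = star_arcs[OF G] and D = star_disjoint[OF G]
  {
    assume "a > 0"
    then obtain x where x: "x \<in> A" using ab by (auto simp: card_gt_0_iff)
    show "\<exists>G' \<in> moves033 G. star12 (a - 1) b G'"
    proof
      show "G \<restriction> (verts G - {x}) \<in> moves033 G"
        using x star_remove_leaf[OF G x] by (intro star_moveI[OF G]) (auto simp: V)
      show "star12 (a - 1) b (G \<restriction> (verts G - {x}))"
        using x fin ab by (intro star12I[OF star_remove_leaf[OF G x]]) auto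
    qed
  next
    assume "b > 0"
    then obtain x where x: "x \<in> B" using ab by (auto simp: card_gt_0_iff)
    show "\<exists>G' \<in> moves033 G. star12 (a + 1) (b - 1) G'"
    proof
      show "G \<restriction> (verts G - {f x}) \<in> moves033 G"
        using x star_remove_tip[OF G x] by (intro star_moveI[OF G]) (auto simp: V)
      show "star12 (a + 1) (b - 1) (G \<restriction> (verts G - {f x}))"
        using D x fin ab by (intro star12I[OF star_remove_tip[OF G x]]) (auto simp: card_insert_if)
    qed
    show "\<exists>G' \<in> moves033 G. star12 a (b - 1) G'"
    proof
      show "G \<restriction> (verts G - {x, f x}) \<in> moves033 G"
        using x star_remove_branch[OF G x]
        by (intro star_moveI[OF G] disjI2) (auto simp: V E)
      show "star12 a (b - 1) (G \<restriction> (verts G - {x, f x}))"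
        using x fin ab by (intro star12I[OF star_remove_branch[OF G x]]) auto
    qed
  next
    assume b: "b = 0" and a: "a \<le> 1"
    have B: "B = {}" using b ab fin by auto
    have "A = {} \<or> (\<exists>x. A = {x})" using a ab fin by (auto simp: le_Suc_eq card_1_singleton_iff)
    \<comment> \<open>Deleting everything is one move, as the star is a single vertex or a single
      edge.\<close>
    then have *: "(\<exists>u. insert c A = {u}) \<or> (\<exists>u v. u \<rightarrow>\<^bsub>G\<^esub> v \<and> insert c A = {u, v})"
      by (auto simp: E)
    show "\<exists>G' \<in> moves033 G. verts G' = {}"
    proof
      show "G \<restriction> (verts G - insert c A) \<in> moves033 G"
        using B by (intro star_moveI[OF G *]) (auto simp: V)
    qed (simp add: V B)
  next
    assume b: "b = 0" and a: "a = 2"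
    have B: "B = {}" using b ab fin by auto
    obtain x y where xy: "A = {x, y}" "x \<noteq> y" using a ab by (auto simp: card_2_iff)
    have W: "verts G - {c, y} = {x}" using xy B D by (auto simp: V)
    have S: "star_on x {} {} f (G \<restriction> (verts G - {c, y}))"
      unfolding W using xy by (intro star_keep_vertex[OF G]) (auto simp: V)
    show "\<exists>G' \<in> moves033 G. star12 0 0 G'"
    proof
      show "G \<restriction> (verts G - {c, y}) \<in> moves033 G"
        using xy S by (intro star_moveI[OF G] disjI2) (auto simp: V E)
      show "star12 0 0 (G \<restriction> (verts G - {c, y}))"
        using S by (intro star12I) auto
    qed
  }
qed

section \<open>The table of values and its mex recursion\<close>

lemma mex_eqI:
  assumes "n \<notin> S" "\<And>m. m < n \<Longrightarrow> m \<in> S"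
  shows "mex S = n"
  unfolding mex_def using assms by (intro Least_equality) (auto simp: not_less[symmetric])

lemma grundy_empty:
  assumes "graph G" "verts G = {}"
  shows "grundy G = 0"
proof -
  have "moves033 G = {}"
    using card_verts_moves033[OF assms(1)] assms(2) by fastforce
  then show ?thesis using assms by (subst grundy.simps) (simp add: mex_eqI)
qed

text \<open>Here \<open>i\<close> counts all paths and \<open>j\<close> the long ones, so the pair
  \<open>(a, b)\<close> has the entry \<open>star_value (a + b) b\<close>. For
  \<open>j \<le> i\<close> all list lookups are in range.\<close>

definition star_value :: "nat \<Rightarrow> nat \<Rightarrow> nat" where
  "star_value i j =
    (if i = 0 then 1 else if i = 1 then [2, 0] ! j else if i = 2 then [0, 1, 2] ! j
     else if i = 3 then [1, 2, 0, 1] ! j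
     else if even i then (if j \<le> 3 then [0, 3, 1, 2] ! j else if even j then 0 else 3)
     else (if j \<le> 3 then [1, 2, 0, 3] ! j else if even j then 1 else 2))"

text \<open>The last set collects the deletions of the centre: 0 stands for the empty graph, 1 for a
  single vertex.\<close>

definition option_values :: "nat \<Rightarrow> nat \<Rightarrow> nat set" where
  "option_values a b =
    {n. a > 0 \<and> n = star_value (a - 1 + b) b} \<union>
    {n. b > 0 \<and> (n = star_value (a + b) (b - 1) \<or> n = star_value (a + b - 1) (b - 1))} \<union>
    {n. b = 0 \<and> (a \<le> 1 \<and> n = 0 \<or> a = 2 \<and> n = 1)}"

text \<open>The table depends only on parities once its arguments are at least 4, and a move lowers
  them by at most 1; hence the bound 5.\<close>

lemma nat_cases5:
  fixes n :: nat
  obtains "n = 0" | "n = 1" | "n = 2" | "n = 3" | "n = 4" | k where "n = k + 5"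
proof (cases "n < 5")
  case True
  then have "n = 0 \<or> n = 1 \<or> n = 2 \<or> n = 3 \<or> n = 4" by linarith
  then show ?thesis using that by blast
next
  case False
  then have "n = n - 5 + 5" by simp
  then show ?thesis using that by blast
qed

text \<open>Splitting \<open>a\<close> and \<open>b\<close> at 5 leaves 36 cases, in which at most
  parities remain open.\<close>

lemma mex_option_values: "mex (option_values a b) = star_value (a + b) b"
proof (rule mex_eqI)
  show "star_value (a + b) b \<notin> option_values a b"
    by (cases a rule: nat_cases5; cases b rule: nat_cases5)
       (simp_all add: star_value_def option_values_def)
  \<comment> \<open>The bound 3 on all entries turns the condition on every smaller \<open>m\<close>
    into one on 0, 1 and 2, which simplification can decide.\<close>
  have calc: "star_value (a + b) b \<le> 3 \<and> (\<forall>m \<in> {0, 1, 2}. m < star_value (a + b) b \<longrightarrow> m \<in> option_values a b)"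
    by (cases a rule: nat_cases5; cases b rule: nat_cases5)
       (simp_all add: star_value_def option_values_def)
  show "m \<in> option_values a b" if "m < star_value (a + b) b" for m
  proof -
    have "m = 0 \<or> m = 1 \<or> m = 2" using calc that by linarith
    then show ?thesis using calc that by auto
  qed
qed

text \<open>Strong induction on the number of vertices: each option is empty or a smaller star, so
  the options have exactly the values in \<open>option_values a b\<close>.\<close>

lemma grundy_star12: "star12 a b G \<Longrightarrow> grundy G = star_value (a + b) b"
proof (induction "card (verts G)" arbitrary: a b G rule: less_induct)
  case less
  note star = less.prems
  have gr: "graph G" using star by (auto simp: star12_def star_on_def)
  have IH: "grundy G' = star_value (a' + b') b'" if "G' \<in> moves033 G" "star12 a' b' G'" for a' b' G'
    using less.hyps[OF card_verts_moves033[OF gr that(1)] that(2)] .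
  have E: "grundy G' = 0" if "G' \<in> moves033 G" "verts G' = {}" for G'
    using grundy_empty graph_moves033[OF gr that(1)] that(2) by blast
  have one: "star_value 0 0 = 1" by (simp add: star_value_def)
  have "grundy ` moves033 G = option_values a b"
  proof (intro equalityI subsetI)
    fix n assume "n \<in> grundy ` moves033 G"
    then obtain G' where G': "G' \<in> moves033 G" "n = grundy G'" by auto
    note IH' = IH[OF G'(1)]
    from star12_moves[OF star G'(1)] show "n \<in> option_values a b"
    proof (elim disjE conjE)
      assume "a > 0" "star12 (a - 1) b G'"
      then show ?thesis using IH' G' by (simp add: option_values_def)
    next
      assume "b > 0" "star12 (a + 1) (b - 1) G'"
      then show ?thesis using IH'[of "a + 1" "b - 1"] G' by (simp add: option_values_def)
    next
      assume "b > 0" "star12 a (b - 1) G'"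
      then show ?thesis using IH'[of a "b - 1"] G' by (simp add: option_values_def)
    next
      assume "verts G' = {}" "b = 0" "a \<le> 1"
      then show ?thesis using E G' by (simp add: option_values_def)
    next
      assume "star12 0 0 G'" "b = 0" "a = 2"
      then show ?thesis using IH'[of 0 0] G' one by (simp add: option_values_def)
    qed
  next
    fix n assume "n \<in> option_values a b"
    \<comment> \<open>Each star value is put into the form \<open>star_value (a' + b') b'\<close> of
      the induction hypothesis; in particular 1 is the value at \<open>(0, 0)\<close>.\<close>
    then consider "a > 0" "n = star_value (a - 1 + b) b"
      | "b > 0" "n = star_value (a + 1 + (b - 1)) (b - 1)"
      | "b > 0" "n = star_value (a + (b - 1)) (b - 1)"
      | "b = 0" "a \<le> 1" "n = 0" | "b = 0" "a = 2" "n = star_value (0 + 0) 0"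
      unfolding option_values_def one by (auto simp: one)
    then show "n \<in> grundy ` moves033 G"
      using star12_moves_exist[OF star] IH E by cases (metis image_eqI)+
  qed
  then show ?case using gr by (subst grundy.simps) (simp add: mex_option_values)
qed

section \<open>From lists of paths to the set description of a star\<close>

text \<open>Induction on the list of paths: a path \<open>[x]\<close> adds \<open>x\<close> to
  \<open>A\<close>, a path \<open>[x, y]\<close> adds \<open>x\<close> to \<open>B\<close> and
  updates \<open>f\<close> to send \<open>x\<close> to \<open>y\<close>. Finiteness is carried along
  so that cardinalities grow by one.\<close>

lemma star_branches:
  assumes "\<forall>p \<in> set ps. length p \<in> {1, 2}" "distinct (concat ps)" "c \<notin> set (concat ps)"
  shows "\<exists>A B f. A \<inter> B = {} \<and> (A \<union> B) \<inter> f ` B = {} \<and> inj_on f B \<and> finite A \<and> finite B \<and>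
     set (concat ps) = A \<union> B \<union> f ` B \<and>
     card A = count_list (map length ps) 1 \<and> card B = count_list (map length ps) 2 \<and>
     (\<forall>u v. (u, v) \<in> (\<Union>p \<in> set ps. set (vwalk_arcs (c # p)) \<union> (set (vwalk_arcs (c # p)))\<inverse>) \<longleftrightarrow>
        u = c \<and> v \<in> A \<union> B \<or> v = c \<and> u \<in> A \<union> B \<or> u \<in> B \<and> v = f u \<or> v \<in> B \<and> u = f v)"
  using assms
proof (induction ps)
  case Nil
  show ?case by (intro exI[of _ "{}"]) auto
next
  case (Cons p ps)
  then have "\<forall>p \<in> set ps. length p \<in> {1, 2}" "distinct (concat ps)" "c \<notin> set (concat ps)"
    by auto
  from Cons.IH[OF this] obtain A B f where
    D: "A \<inter> B = {}" "(A \<union> B) \<inter> f ` B = {}" "inj_on f B" "finite A" "finite B"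
    and V: "set (concat ps) = A \<union> B \<union> f ` B"
    and C: "card A = count_list (map length ps) 1" "card B = count_list (map length ps) 2"
    and E: "\<forall>u v. (u, v) \<in> (\<Union>p \<in> set ps. set (vwalk_arcs (c # p)) \<union> (set (vwalk_arcs (c # p)))\<inverse>) \<longleftrightarrow>
        u = c \<and> v \<in> A \<union> B \<or> v = c \<and> u \<in> A \<union> B \<or> u \<in> B \<and> v = f u \<or> v \<in> B \<and> u = f v"
    by (elim exE conjE) (rule that)
  have new: "set p \<inter> (A \<union> B \<union> f ` B) = {}" "c \<notin> set p" "distinct p"
    using Cons.prems unfolding V[symmetric] by auto
  \<comment> \<open>The arcs of the new path are separated from the old ones, which the induction
    hypothesis describes.\<close>
  have split: "(u, v) \<in> (\<Union>p \<in> set (p # ps). set (vwalk_arcs (c # p)) \<union> (set (vwalk_arcs (c # p)))\<inverse>) \<longleftrightarrow>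
      (u, v) \<in> set (vwalk_arcs (c # p)) \<or> (v, u) \<in> set (vwalk_arcs (c # p)) \<or>
      u = c \<and> v \<in> A \<union> B \<or> v = c \<and> u \<in> A \<union> B \<or> u \<in> B \<and> v = f u \<or> v \<in> B \<and> u = f v" for u v
    unfolding E[rule_format, symmetric] by auto
  from Cons.prems have "length p = 1 \<or> length p = 2" by auto
  then show ?case
  proof
    assume "length p = 1"
    then obtain x where p: "p = [x]" by (auto simp: length_Suc_conv)
    have x: "x \<notin> A" "x \<notin> B" "x \<notin> f ` B" using new p by auto
    show ?thesis
      unfolding split
    proof (intro exI conjI allI)
      show "insert x A \<inter> B = {}" "(insert x A \<union> B) \<inter> f ` B = {}" "inj_on f B" "finite (insert x A)" "finite B"
        using D x by auto
      show "set (concat (p # ps)) = insert x A \<union> B \<union> f ` B"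
        using V p by simp
      show "card (insert x A) = count_list (map length (p # ps)) 1"
        "card B = count_list (map length (p # ps)) 2"
        using C D x p by simp_all
    qed (auto simp: p)
  next
    assume "length p = 2"
    then obtain x y where p: "p = [x, y]" by (auto simp: length_Suc_conv numeral_2_eq_2)
    have x: "x \<notin> A" "x \<notin> B" "x \<notin> f ` B" "y \<notin> A" "y \<notin> B" "y \<notin> f ` B" "x \<noteq> y" using new p by auto
    \<comment> \<open>As \<open>x\<close> is not in \<open>B\<close>, the update leaves the old tips
      unchanged.\<close>
    have img: "f(x := y) ` insert x B = insert y (f ` B)" using x by auto
    show ?thesis
      unfolding split
    proof (intro exI conjI allI)
      show "A \<inter> insert x B = {}" "finite A" "finite (insert x B)" using D x by auto
      show "(A \<union> insert x B) \<inter> f(x := y) ` insert x B = {}"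
        unfolding img using D(1,2) x by blast
      show "inj_on (f(x := y)) (insert x B)"
        using D(3) x by (auto simp: inj_on_def)
      show "set (concat (p # ps)) = A \<union> insert x B \<union> f(x := y) ` insert x B"
        unfolding img using V p by auto
      show "card A = count_list (map length (p # ps)) 1"
        "card (insert x B) = count_list (map length (p # ps)) 2"
        using C D x p by simp_all
      show "((u, v) \<in> set (vwalk_arcs (c # p)) \<or> (v, u) \<in> set (vwalk_arcs (c # p)) \<or>
          u = c \<and> v \<in> A \<union> B \<or> v = c \<and> u \<in> A \<union> B \<or> u \<in> B \<and> v = f u \<or> v \<in> B \<and> u = f v) \<longleftrightarrow>
          u = c \<and> v \<in> A \<union> insert x B \<or> v = c \<and> u \<in> A \<union> insert x B \<or>
          u \<in> insert x B \<and> v = (f(x := y)) u \<or> v \<in> insert x B \<and> u = (f(x := y)) v" for u v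
        using x by (auto simp: p)
    qed
  qed
qed

lemma count_list_one_two:
  "set ls \<subseteq> {1, 2 :: nat} \<Longrightarrow> count_list ls 1 + count_list ls 2 = length ls"
  by (induction ls) auto

lemma subdivided_star_star12:
  assumes "subdivided_star ls S" "set ls \<subseteq> {1, 2}"
  shows "star12 (count_list ls 1) (count_list ls 2) S"
proof -
  obtain c ps where ps: "map length ps = ls" "distinct (c # concat ps)"
    and V: "verts S = set (c # concat ps)"
    and E: "arcs_ends S = (\<Union>p \<in> set ps. set (vwalk_arcs (c # p)) \<union> (set (vwalk_arcs (c # p)))\<inverse>)"
    and gr: "graph S"
    using assms(1) unfolding subdivided_star_def by blast
  have "\<forall>p \<in> set ps. length p \<in> {1, 2}" "distinct (concat ps)" "c \<notin> set (concat ps)"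
    using ps(2) assms(2) unfolding ps(1)[symmetric] by auto
  from star_branches[OF this] obtain A B f where
    D: "A \<inter> B = {}" "(A \<union> B) \<inter> f ` B = {}" "inj_on f B" "set (concat ps) = A \<union> B \<union> f ` B"
    and C: "card A = count_list ls 1" "card B = count_list ls 2"
    and E': "\<forall>u v. (u, v) \<in> arcs_ends S \<longleftrightarrow>
        u = c \<and> v \<in> A \<union> B \<or> v = c \<and> u \<in> A \<union> B \<or> u \<in> B \<and> v = f u \<or> v \<in> B \<and> u = f v"
    unfolding E[symmetric] ps(1) by (elim exE conjE) (rule that)
  have "c \<notin> A \<union> B \<union> f ` B" using ps(2) D(4) by auto
  moreover have "verts S = insert c (A \<union> B \<union> f ` B)" using V D(4) by simp
  ultimately have "star_on c A B f S" using gr D E' unfolding star_on_def by blast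
  with C show ?thesis by (blast intro: star12I)
qed

theorem theorem3:
  fixes S :: "('a, 'b) pre_digraph" and ls :: "nat list" and i j :: nat
  assumes "subdivided_star ls S"
    and "set ls \<subseteq> {1, 2}"
    and "i = length ls"
    and "j = count_list ls 2"
  shows "(i = 0 \<longrightarrow> grundy S = 1)
    \<and> (i = 1 \<longrightarrow> grundy S = [2, 0] ! j)
    \<and> (i = 2 \<longrightarrow> grundy S = [0, 1, 2] ! j)
    \<and> (i = 3 \<longrightarrow> grundy S = [1, 2, 0, 1] ! j)
    \<and> (i \<ge> 4 \<and> even i \<longrightarrow>
         (j \<le> 3 \<longrightarrow> grundy S = [0, 3, 1, 2] ! j) \<and>
         (j \<ge> 4 \<longrightarrow> grundy S = (if even j then 0 else 3)))
    \<and> (i \<ge> 5 \<and> odd i \<longrightarrow>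
         (j \<le> 3 \<longrightarrow> grundy S = [1, 2, 0, 3] ! j) \<and>
         (j \<ge> 4 \<longrightarrow> grundy S = (if even j then 1 else 2)))
    \<and> (\<forall>E :: ('a, 'b) pre_digraph. graph E \<and> verts E = {} \<longrightarrow> grundy E = 0)"
proof -
  \<comment> \<open>All lengths are 1 or 2, so the two counts add up to \<open>i\<close>.\<close>
  have "grundy S = star_value i j"
    using grundy_star12[OF subdivided_star_star12[OF assms(1,2)]] count_list_one_two[OF assms(2)]
    by (simp add: assms(3,4))
  then show ?thesis by (simp add: star_value_def grundy_empty)
qed

end
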